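(* Let $K, L, N$ be positive integers with $L\le K$, let $0\le M\le N$, and let $R^*(M)$ denote the optimal rate-memory trade-off of the $(K,L,N)$ multi-access coded caching (MACC) scheme. Then $$R^*(M)\ \ge\ \max_{\substack{s\in\{1,2,\ldots,K\}\\ l\in\{1,2,\ldots,\lceil N/s\rceil\}}}\ \frac{1}{l}\left\{N-\left(1-\frac{p}{K}\right)(N-ls)^+-(N-lK)^+-pM\right\},$$ where $p=\min(s+L-1,K)$ (depending on $s$) and $(x)^+=\max(0,x)$.
   Context: Notation: for a positive integer $m$, $[m]=\{1,\ldots,m\}$. For integers $i$ and $K$, $\langle i\rangle_K$ denotes $i \bmod K$ if this is nonzero, and $K$ otherwise. The $(K,L,N)$ MACC network. A central server has a library of $N$ independent files $W_1,\ldots,W_N$, each of size 1 unit ($F$ bits; all sizes and entropies are measured in units of $F$ bits, so $H(W_n)=1$ for each $n$ and $H(W_1,\ldots,W_N)=N$). There are $K$ users $\mathcal{U}_1,\ldots,\mathcal{U}_K$, connected to the server by an error-free shared (broadcast) link, and $K$ caches $\mathcal{Z}_1,\ldots,\mathcal{Z}_K$, each of size $M$ units, $0\le M\le N$. User $\mathcal{U}_k$ has access to the $L$ cyclically consecutive caches with indices in $\mathcal{L}_k=\{k,\langle k+1\rangle_K,\ldots,\langle k+L-1\rangle_K\}$. Schemes. In the placement phase, without knowledge of the demands, the server stores in cache $\mathcal{Z}_k$ a content $Z_k$ which is an arbitrary function of the files $W_1,\ldots,W_N$ (coded placement is allowed) and has size at most $M$ units (so $H(Z_k)\le M$). In the delivery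 phase, user $\mathcal{U}_k$ demands a file $W_{d_k}$, where $d_k\in[N]$ is a realization of a random variable $D_k$; the variables $D_1,\ldots,D_K$ are independent and uniform on $[N]$. For each demand vector $\mathbf{d}=(d_1,\ldots,d_K)\in[N]^K$ the server broadcasts a transmission $X$, which is a function of the files (depending on $\mathbf{d}$), of size $R$ units (so $H(X)\le R$); $R\ge 0$ is called the rate. The decodability condition is that for every $k\in[K]$, $H(W_{d_k}\mid Z_{\mathcal{L}_k},D_k=d_k,X)=0$, where $Z_{\mathcal{L}_k}$ is the collection of contents $Z_j$, $j\in\mathcal{L}_k$. A memory-rate pair $(M,R)$ is achievable if there is a scheme with cache memory $M$ that satisfies the decodability condition with rate at most $R$ for every possible demand vector. The optimal rate-memory trade-off is $R^*(M)=\inf\{R:(M,R)\text{ is achievable}\}$. *)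

theory Defs
  imports "HOL-Probability.Information"
begin

section \<open>Multi-access coded caching networks\<close>

subsection \<open>Cyclic cache access\<close>

definition wrap :: "nat \<Rightarrow> nat \<Rightarrow> nat" where
  "wrap K i = (if i mod K = 0 then K else i mod K)"

definition accessed_caches :: "nat \<Rightarrow> nat \<Rightarrow> nat \<Rightarrow> nat set" where
  "accessed_caches K L k = (\<lambda>i. wrap K (k + i)) ` {0..<L}"


subsection \<open>Files and demands\<close>

text \<open>
  A file of \<open>F\<close> bits with entropy \<open>F\<close> bits is a uniformly distributed bit string of
  length \<open>F\<close>; \<open>N\<close> independent ones form a uniform element of \<open>libraries N F\<close>.
  The demand vector is a uniform element of \<open>demands K N\<close>, independent of the files.
\<close>

definition libraries :: "nat \<Rightarrow> nat \<Rightarrow> (nat \<Rightarrow> bool list) set" where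
  "libraries N F = {1..N} \<rightarrow>\<^sub>E {w. length w = F}"

definition demands :: "nat \<Rightarrow> nat \<Rightarrow> (nat \<Rightarrow> nat) set" where
  "demands K N = {1..K} \<rightarrow>\<^sub>E {1..N}"

type_synonym outcome = "(nat \<Rightarrow> bool list) \<times> (nat \<Rightarrow> nat)"

definition macc_space :: "nat \<Rightarrow> nat \<Rightarrow> nat \<Rightarrow> outcome measure" where
  "macc_space K N F = uniform_count_measure (libraries N F \<times> demands K N)"

definition file_at :: "nat \<Rightarrow> outcome \<Rightarrow> bool list" where
  "file_at n \<omega> = fst \<omega> n"

definition demand :: "nat \<Rightarrow> outcome \<Rightarrow> nat" where
  "demand k \<omega> = snd \<omega> k"

definition given_demand :: "nat \<Rightarrow> nat \<Rightarrow> nat \<Rightarrow> nat \<Rightarrow> nat \<Rightarrow> outcome measure" where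
  "given_demand K N F k n =
     uniform_measure (macc_space K N F) {\<omega> \<in> space (macc_space K N F). demand k \<omega> = n}"


subsection \<open>Entropy in units of \<open>F\<close> bits\<close>

text \<open>Taking logarithms to base \<open>2 ^ F\<close> measures entropy in units of \<open>F\<close> bits.\<close>

definition ent :: "nat \<Rightarrow> 'a measure \<Rightarrow> ('a \<Rightarrow> 'b) \<Rightarrow> real" where
  "ent F P X = prob_space.entropy P (2 ^ F) (count_space (X ` space P)) X"

definition cond_ent :: "nat \<Rightarrow> 'a measure \<Rightarrow> ('a \<Rightarrow> 'b) \<Rightarrow> ('a \<Rightarrow> 'c) \<Rightarrow> real" where
  "cond_ent F P X Y = prob_space.conditional_entropy P (2 ^ F)
     (count_space (X ` space P)) (count_space (Y ` space P)) X Y"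


subsection \<open>Schemes and the rate-memory trade-off\<close>

text \<open>
  \<open>Z k\<close> is the placement function of cache \<open>k\<close> and \<open>X d\<close> the encoding function of the
  transmission for demand vector \<open>d\<close>. There are only finitely many libraries, so contents and
  transmissions may be labelled by natural numbers without loss of generality. The function
  \<open>cached\<close> collects the contents of the caches in \<open>S\<close>; outside \<open>S\<close> it carries no information.
  The memory and rate constraints are entropy constraints, so they hold in particular for
  contents and transmissions of at most \<open>M * F\<close> and \<open>R * F\<close> bits.
\<close>

definition cached ::
    "(nat \<Rightarrow> (nat \<Rightarrow> bool list) \<Rightarrow> nat) \<Rightarrow> nat set \<Rightarrow> (nat \<Rightarrow> bool list) \<Rightarrow> nat \<Rightarrow> nat" where
  "cached Z S w = restrict (\<lambda>j. Z j w) S"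

definition macc_scheme ::
    "nat \<Rightarrow> nat \<Rightarrow> nat \<Rightarrow> nat \<Rightarrow> real \<Rightarrow> real
      \<Rightarrow> (nat \<Rightarrow> (nat \<Rightarrow> bool list) \<Rightarrow> nat)
      \<Rightarrow> ((nat \<Rightarrow> nat) \<Rightarrow> (nat \<Rightarrow> bool list) \<Rightarrow> nat) \<Rightarrow> bool" where
  "macc_scheme K L N F M R Z X \<longleftrightarrow>
     (\<forall>k\<in>{1..K}. ent F (macc_space K N F) (\<lambda>\<omega>. Z k (fst \<omega>)) \<le> M) \<and>
     (\<forall>d\<in>demands K N.
        ent F (macc_space K N F) (\<lambda>\<omega>. X d (fst \<omega>)) \<le> R \<and>
        (\<forall>k\<in>{1..K}.
           cond_ent F (given_demand K N F k (d k)) (file_at (d k))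
             (\<lambda>\<omega>. (cached Z (accessed_caches K L k) (fst \<omega>), X d (fst \<omega>))) = 0))"

definition achievable :: "nat \<Rightarrow> nat \<Rightarrow> nat \<Rightarrow> real \<Rightarrow> real \<Rightarrow> bool" where
  "achievable K L N M R \<longleftrightarrow> 0 \<le> R \<and> (\<exists>F>0. \<exists>Z X. macc_scheme K L N F M R Z X)"

definition opt_rate :: "nat \<Rightarrow> nat \<Rightarrow> nat \<Rightarrow> real \<Rightarrow> real" where
  "opt_rate K L N M = Inf {R. achievable K L N M R}"

end

theory Submission
  imports Defs
begin

text \<open>
  Fix \<open>s\<close>, \<open>l\<close>, and let the window \<open>W\<^sub>i\<close> consist of the \<open>p\<close> caches seen by the \<open>s\<close> users starting
  cyclically at \<open>i\<close>. Choose \<open>l\<close> demand vectors such that these users request the files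
  \<open>A = {1..min (l * s) N}\<close> and all users together request \<open>{1..min (l * K) N}\<close>. With \<open>X\<close> the \<open>l\<close>
  transmissions and \<open>Z\<close> all the caches, submodularity of entropy gives
  \<open>N - (N - l * K)\<^sup>+ \<le> H(Z, X) \<le> H(W\<^sub>i, X) + H(Z, A) - H(W\<^sub>i, A)\<close>, where \<open>H(W\<^sub>i, X) \<le> p * M + l * R\<close>.
  Averaged over \<open>i\<close>, \<open>H(W\<^sub>i, A)\<close> is at least \<open>p/K\<close> times \<open>H(Z, A)\<close> plus \<open>1 - p/K\<close> times \<open>H(A)\<close>,
  since the average is concave in the window length; and \<open>H(Z, A) - H(A)\<close> is at most
  \<open>(N - l * s)\<^sup>+\<close>. Only the polymatroid axioms for entropy enter this argument.
\<close>

section \<open>Polymatroids\<close>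

locale polymatroid =
  fixes rk :: "'v set \<Rightarrow> real"
  assumes rk_empty: "rk {} = 0"
    and rk_mono: "S \<subseteq> T \<Longrightarrow> rk S \<le> rk T"
    and rk_submodular: "rk (S \<union> T) + rk (S \<inter> T) \<le> rk S + rk T"
begin

lemma rk_nonneg: "0 \<le> rk S"
  using rk_mono[of "{}" S] rk_empty by simp

lemma rk_Un_le: "rk (S \<union> T) \<le> rk S + rk T"
  using rk_submodular[of S T] rk_nonneg[of "S \<inter> T"] by simp

lemma rk_UN_le: "finite I \<Longrightarrow> rk (\<Union>i\<in>I. f i) \<le> (\<Sum>i\<in>I. rk (f i))"
proof (induction I rule: finite_induct)
  case (insert i I)
  then show ?case
    using rk_Un_le[of "f i" "\<Union>i\<in>I. f i"] by simp
qed (simp add: rk_empty)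

lemma rk_image_le:
  assumes "finite I" and "\<And>i. i \<in> I \<Longrightarrow> rk {f i} \<le> c"
  shows "rk (f ` I) \<le> real (card I) * c"
proof -
  have "rk (f ` I) \<le> (\<Sum>i\<in>I. rk {f i})"
    using rk_UN_le[OF assms(1), of "\<lambda>i. {f i}"] by (simp add: UNION_singleton_eq_range)
  also have "\<dots> \<le> (\<Sum>i\<in>I. c)"
    using assms(2) by (rule sum_mono)
  finally show ?thesis by simp
qed

text \<open>The premise encodes that \<open>v\<close> is a function of \<open>S\<close> (zero
  conditional entropy). By submodularity the gain from adding \<open>v\<close> can only shrink when
  \<open>S\<close> grows to \<open>T\<close>.\<close>

lemma determined_mono:
  assumes "rk (insert v S) \<le> rk S" "S \<subseteq> T"
  shows "rk (insert v T) = rk T"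
proof -
  have "rk (insert v S \<union> T) + rk (insert v S \<inter> T) \<le> rk (insert v S) + rk T"
    by (rule rk_submodular)
  moreover have "rk S \<le> rk (insert v S \<inter> T)"
    using assms(2) by (intro rk_mono) auto
  moreover have "insert v S \<union> T = insert v T"
    using assms(2) by auto
  moreover have "rk T \<le> rk (insert v T)"
    by (intro rk_mono) auto
  ultimately show ?thesis
    using assms(1) by simp
qed

lemma determined_Un:
  assumes "finite B" and "\<And>v. v \<in> B \<Longrightarrow> rk (insert v T) \<le> rk T"
  shows "rk (T \<union> B) = rk T"
  using assms
proof (induction B rule: finite_induct)
  case (insert v B)
  have "rk (insert v (T \<union> B)) = rk (T \<union> B)"
    using insert.prems by (intro determined_mono[of v T]) auto
  then show ?case
    using insert by simp
qed simp

end


section \<open>Cyclic windows\<close>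

lemma wrap_mod [simp]: "wrap K i mod K = i mod K"
  by (simp add: wrap_def)

lemma wrap_cong: "i mod K = j mod K \<Longrightarrow> wrap K i = wrap K j"
  by (simp add: wrap_def)

lemma wrap_in: "0 < K \<Longrightarrow> wrap K i \<in> {1..K}"
  by (auto simp: wrap_def Suc_le_eq intro: less_imp_le)

lemma wrap_id: "k \<in> {1..K} \<Longrightarrow> wrap K k = k"
  by (cases "k = K") (auto simp: wrap_def)

lemma wrap_wrap_add: "wrap K (wrap K i + j) = wrap K (i + j)"
  by (rule wrap_cong) (metis mod_add_left_eq wrap_mod)

text \<open>Recovers a user's offset from the window start \<open>i\<close>; adding
  \<open>K - i\<close> avoids truncated subtraction.\<close>

lemma wrap_shift_back:
  assumes "i < K" "t < K"
  shows "(wrap K (i + t) + (K - i)) mod K = t"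
proof -
  have "(wrap K (i + t) + (K - i)) mod K = ((i + t) + (K - i)) mod K"
    by (metis mod_add_left_eq wrap_mod)
  also have "(i + t) + (K - i) = t + K"
    using assms by simp
  finally show ?thesis
    using assms by simp
qed

lemma finite_accessed_caches [simp]: "finite (accessed_caches K q i)"
  by (simp add: accessed_caches_def)

lemma card_accessed_caches_le: "card (accessed_caches K q i) \<le> q"
  unfolding accessed_caches_def by (rule order_trans[OF card_image_le]) auto

lemma accessed_caches_0 [simp]: "accessed_caches K 0 i = {}"
  by (simp add: accessed_caches_def)

lemma accessed_caches_subset: "0 < K \<Longrightarrow> accessed_caches K q i \<subseteq> {1..K}"
  using wrap_in unfolding accessed_caches_def by blast

lemma accessed_caches_period: "accessed_caches K q (i + K) = accessed_caches K q i"
  unfolding accessed_caches_def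
  by (intro image_cong refl wrap_cong) (metis add.assoc add.commute mod_add_self2)

lemma accessed_caches_full:
  assumes "0 < K"
  shows "accessed_caches K K i = {1..K}"
proof
  show "accessed_caches K K i \<subseteq> {1..K}"
    using accessed_caches_subset[OF assms] .
next
  show "{1..K} \<subseteq> accessed_caches K K i"
  proof
    fix k assume k: "k \<in> {1..K}"
    \<comment> \<open>The cyclic distance from \<open>i\<close> to \<open>k\<close>. Since
      \<open>i\<close> may exceed \<open>K\<close>, it is reduced before being subtracted.\<close>
    define t where "t = (k + (K - i mod K)) mod K"
    have "(i + t) mod K = (i mod K + (k + (K - i mod K))) mod K"
      unfolding t_def by (metis mod_add_eq mod_mod_trivial)
    also have "i mod K + (k + (K - i mod K)) = k + K"
      using assms mod_less_divisor[of K i] by linarith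
    finally have "wrap K (i + t) = wrap K k"
      by (intro wrap_cong) simp
    then have "k = wrap K (i + t)"
      using k by (simp add: wrap_id)
    moreover have "t \<in> {0..<K}"
      using assms by (simp add: t_def)
    ultimately show "k \<in> accessed_caches K K i"
      unfolding accessed_caches_def by blast
  qed
qed

lemma accessed_caches_mono: "q \<le> r \<Longrightarrow> accessed_caches K q i \<subseteq> accessed_caches K r i"
  unfolding accessed_caches_def by (intro image_mono) auto

text \<open>Peeling off the first cache instead of the last relates windows starting at
  \<open>i\<close> and \<open>Suc i\<close>, the pair to which submodularity is applied.\<close>

lemma accessed_caches_step:
  "accessed_caches K (Suc q) i = insert (wrap K i) (accessed_caches K q (Suc i))"
  unfolding accessed_caches_def
  by (simp only: atLeast0_lessThan_Suc_eq_insert_0 image_insert image_image) simp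

text \<open>Offsets add up to at most \<open>(s - 1) + (L - 1)\<close>, so \<open>s + L - 1\<close>
  consecutive caches suffice unless they already wrap around the whole ring.\<close>

lemma accessed_caches_within:
  assumes "0 < K" "t < s"
  shows "accessed_caches K L (wrap K (i + t)) \<subseteq> accessed_caches K (min (s + L - 1) K) i"
proof (cases "s + L - 1 \<le> K")
  case True
  show ?thesis
  proof
    fix c assume "c \<in> accessed_caches K L (wrap K (i + t))"
    then obtain y where y: "y < L" "c = wrap K (i + (t + y))"
      by (auto simp: accessed_caches_def wrap_wrap_add add.assoc)
    then show "c \<in> accessed_caches K (min (s + L - 1) K) i"
      using assms True by (auto simp: accessed_caches_def intro!: image_eqI[of _ _ "t + y"])
  qed
next
  case False
  then show ?thesis
    using accessed_caches_subset[OF assms(1)] accessed_caches_full[OF assms(1)] by simp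
qed

text \<open>A concave sequence starting at 0 has nonincreasing ratios \<open>g q / q\<close>;
  clearing denominators admits \<open>p = 0\<close>.\<close>

lemma concave_chord:
  fixes g :: "nat \<Rightarrow> real"
  assumes "g 0 = 0" and conc: "\<And>q. Suc (Suc q) \<le> K \<Longrightarrow> g (Suc (Suc q)) + g q \<le> 2 * g (Suc q)"
    and "p \<le> K"
  shows "real p * g K \<le> real K * g p"
proof -
  \<comment> \<open>Induction: add the hypothesis for \<open>q\<close> to the concavity inequality
    multiplied by \<open>Suc q\<close>.\<close>
  have ratio: "real q * g (Suc q) \<le> real (Suc q) * g q" if "Suc q \<le> K" for q
    using that
  proof (induction q)
    case 0
    then show ?case by (simp add: assms)
  next
    case (Suc q)
    have "real (Suc q) * (g (Suc (Suc q)) + g q) \<le> real (Suc q) * (2 * g (Suc q))"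
      using conc[of q] Suc.prems by (intro mult_left_mono) auto
    with Suc show ?case
      by (simp add: algebra_simps)
  qed
  show ?thesis
  proof (cases "p = 0")
    case True
    then show ?thesis by (simp add: assms)
  next
    case False
    have "g K / real K \<le> g p / real p"
      using \<open>p \<le> K\<close>
    proof (induction rule: dec_induct)
      case base
      show ?case by simp
    next
      case (step q)
      have "g (Suc q) / real (Suc q) \<le> g q / real q"
        using \<open>p \<le> q\<close> False \<open>q < K\<close> ratio[of q]
        by (simp add: field_simps del: of_nat_Suc)
      with step show ?case by simp
    qed
    then show ?thesis
      using False \<open>p \<le> K\<close> by (simp add: field_simps)
  qed
qed

section \<open>Averaging rank over cyclic windows\<close>

context polymatroid
begin

text \<open>
  By submodularity of two windows of length \<open>q\<close> that are shifted by one, the total rank of the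
  \<open>K\<close> windows of length \<open>q\<close> is concave in \<open>q\<close>.
\<close>

lemma sum_windows_ge:
  fixes f :: "nat \<Rightarrow> 'v" and A :: "'v set"
  assumes K: "0 < K" and p: "p \<le> K"
  shows "real p * rk (f ` {1..K} \<union> A) + (real K - real p) * rk A
    \<le> (\<Sum>i<K. rk (f ` accessed_caches K p i \<union> A))"
proof -
  define G where "G q = (\<Sum>i<K. rk (f ` accessed_caches K q i \<union> A))" for q
  have G0: "G 0 = real K * rk A"
    by (simp add: G_def)
  have GK: "G K = real K * rk (f ` {1..K} \<union> A)"
    by (simp add: G_def accessed_caches_full[OF K])
  \<comment> \<open>Rotating all windows by one permutes them, so both windows in the submodularity
    step contribute the same total.\<close>
  have shift: "G q = (\<Sum>i<K. rk (f ` accessed_caches K q (Suc i) \<union> A))" for q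
  proof -
    have "accessed_caches K q K = accessed_caches K q 0"
      using accessed_caches_period[of K q 0] by simp
    then show ?thesis
      using sum.lessThan_Suc_shift[of "\<lambda>i. rk (f ` accessed_caches K q i \<union> A)" K]
      by (simp add: G_def)
  qed
  have conc: "G (Suc (Suc q)) + G q \<le> 2 * G (Suc q)" for q
  proof -
    let ?w = "\<lambda>q i. f ` accessed_caches K q i \<union> A"
    have "rk (?w (Suc (Suc q)) i) + rk (?w q (Suc i)) \<le> rk (?w (Suc q) i) + rk (?w (Suc q) (Suc i))" for i
    proof -
      have "wrap K i \<in> accessed_caches K (Suc q) i"
        by (simp add: accessed_caches_step)
      moreover have "accessed_caches K (Suc q) i \<subseteq> accessed_caches K (Suc (Suc q)) i"
        by (rule accessed_caches_mono) simp
      ultimately have "?w (Suc (Suc q)) i = ?w (Suc q) i \<union> ?w (Suc q) (Suc i)"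
        using accessed_caches_step[of K "Suc q" i] by auto
      moreover have "?w q (Suc i) \<subseteq> ?w (Suc q) i \<inter> ?w (Suc q) (Suc i)"
        using accessed_caches_step[of K q i] accessed_caches_mono[of q "Suc q" K "Suc i"] by auto
      ultimately show ?thesis
        using rk_submodular[of "?w (Suc q) i" "?w (Suc q) (Suc i)"]
          rk_mono[of "?w q (Suc i)" "?w (Suc q) i \<inter> ?w (Suc q) (Suc i)"] by simp
    qed
    then have "(\<Sum>i<K. rk (?w (Suc (Suc q)) i) + rk (?w q (Suc i)))
        \<le> (\<Sum>i<K. rk (?w (Suc q) i) + rk (?w (Suc q) (Suc i)))"
      by (intro sum_mono)
    then show ?thesis
      by (simp add: sum.distrib shift[symmetric]) (simp add: G_def)
  qed
  \<comment> \<open>Subtracting \<open>G 0\<close> keeps concavity and meets the requirement of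
    value 0 at 0.\<close>
  have "real p * (G K - G 0) \<le> real K * (G p - G 0)"
    using conc p by (intro concave_chord[where g = "\<lambda>q. G q - G 0"]) (auto simp: algebra_simps)
  then have "real K * (real p * (rk (f ` {1..K} \<union> A) - rk A)) \<le> real K * (G p - real K * rk A)"
    unfolding G0 GK by (simp add: algebra_simps)
  then have "real p * (rk (f ` {1..K} \<union> A) - rk A) \<le> G p - real K * rk A"
    using K by simp
  then show ?thesis
    by (simp add: G_def algebra_simps)
qed

end


section \<open>The bound for polymatroids\<close>

text \<open>The ground set of the polymatroid. Indexing transmissions by demand vectors lets those
  for several demands be considered jointly, as functions of one library.\<close>

datatype macc_var = File nat | Cache nat | Transmission "nat \<Rightarrow> nat"

text \<open>
  The \<open>j\<close>-th of \<open>l\<close> demand vectors for the shift \<open>i\<close>: over all \<open>j < l\<close>, the \<open>s\<close> users starting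
  cyclically at \<open>i\<close> request the files \<open>1, \<dots>, l * s\<close>, the others the next \<open>l * (K - s)\<close> ones,
  as far as they exist.
\<close>

definition demand_vec :: "nat \<Rightarrow> nat \<Rightarrow> nat \<Rightarrow> nat \<Rightarrow> nat \<Rightarrow> nat \<Rightarrow> nat \<Rightarrow> nat" where
  "demand_vec K N s l i j = (\<lambda>k\<in>{1..K}. let t = (k + (K - i)) mod K in
     min N (Suc (if t < s then j * s + t else l * s + (j * (K - s) + (t - s)))))"

lemma demand_vec_in: "0 < N \<Longrightarrow> demand_vec K N s l i j \<in> demands K N"
  by (auto simp: demand_vec_def demands_def Let_def)

lemma demand_vec_at:
  assumes "i < K" "t < K"
  shows "demand_vec K N s l i j (wrap K (i + t)) =
    min N (Suc (if t < s then j * s + t else l * s + (j * (K - s) + (t - s))))"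
  using assms wrap_in[of K "i + t"] wrap_shift_back[OF assms]
  by (simp add: demand_vec_def Let_def del: diff_add_assoc diff_add_assoc2 Nat.add_diff_assoc)

text \<open>Division with remainder, \<open>n - 1 = j * s + t\<close>, yields the demand vector
  \<open>j\<close> and the user offset \<open>t\<close> that request file \<open>n\<close>.\<close>

lemma demand_vec_first_cover:
  assumes "i < K" "s \<le> K" "n \<in> {1..min (l * s) N}"
  obtains j t where "j < l" "t < s" "demand_vec K N s l i j (wrap K (i + t)) = n"
proof
  have s: "0 < s"
    using assms by (cases s) auto
  show "(n - 1) div s < l"
    using assms s by (simp add: div_less_iff_less_mult) linarith
  show "(n - 1) mod s < s"
    using s by simp
  then show "demand_vec K N s l i ((n - 1) div s) (wrap K (i + (n - 1) mod s)) = n"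
    using assms by (subst demand_vec_at) auto
qed

lemma demand_vec_cover:
  assumes "i < K" "s \<le> K" "n \<in> {1..min (l * K) N}"
  obtains j t where "j < l" "t < K" "demand_vec K N s l i j (wrap K (i + t)) = n"
proof (cases "n \<le> l * s")
  case True
  then have "n \<in> {1..min (l * s) N}"
    using assms by simp
  then show thesis
    using demand_vec_first_cover[OF assms(1,2)] that assms(2) by (metis order_less_le_trans)
next
  case False
  \<comment> \<open>The zero-based position of \<open>n\<close> behind the first
    \<open>l * s\<close> files; dividing it by \<open>K - s\<close> locates the request among the
    remaining users.\<close>
  define m where "m = n - 1 - l * s"
  have n: "n = Suc (l * s + m)"
    using False by (simp add: m_def)
  have m: "m < l * (K - s)"
    using assms n by (simp add: diff_mult_distrib2 less_diff_conv)
  \<comment> \<open>For \<open>s = K\<close> no file lies between \<open>l * s\<close> and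
    \<open>l * K\<close>.\<close>
  then have r: "0 < K - s"
    by (cases "K - s") auto
  have "m div (K - s) < l"
    using m r by (simp add: div_less_iff_less_mult)
  moreover have t: "s + m mod (K - s) < K"
    using r mod_less_divisor[OF r, of m] by linarith
  moreover have "demand_vec K N s l i (m div (K - s)) (wrap K (i + (s + m mod (K - s)))) = n"
    using assms t n div_mult_mod_eq[of m "K - s"] by (subst demand_vec_at) (simp_all del: div_mult_mod_eq)
  ultimately show thesis
    by (rule that)
qed

text \<open>The interface between entropy and combinatorics: \<open>rk_files\<close> and
  \<open>rk_file\<close> express independence of unit-size files, \<open>rk_le_N\<close> that every
  variable is a function of the library, and \<open>decodable\<close> that a conditional entropy
  vanishes.\<close>

locale macc_polymatroid = polymatroid rk for rk :: "macc_var set \<Rightarrow> real" +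
  fixes K L N :: nat and M R :: real
  assumes K_pos: "0 < K" and N_pos: "0 < N" and M_nonneg: "0 \<le> M"
    and rk_files: "real N \<le> rk (File ` {1..N})"
    and rk_le_N: "rk S \<le> real N"
    and rk_file: "n \<in> {1..N} \<Longrightarrow> rk {File n} \<le> 1"
    and rk_cache: "k \<in> {1..K} \<Longrightarrow> rk {Cache k} \<le> M"
    and rk_transmission: "d \<in> demands K N \<Longrightarrow> rk {Transmission d} \<le> R"
    and decodable: "d \<in> demands K N \<Longrightarrow> k \<in> {1..K} \<Longrightarrow>
      rk (insert (File (d k)) (Cache ` accessed_caches K L k \<union> {Transmission d}))
        \<le> rk (Cache ` accessed_caches K L k \<union> {Transmission d})"
begin

text \<open>The other \<open>N - n\<close> files raise the rank of \<open>S\<close> by at most one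
  each and bring it to at least \<open>N\<close>.\<close>

lemma rk_files_ge:
  assumes "n \<le> N" "File ` {1..n} \<subseteq> S"
  shows "real n \<le> rk S"
proof -
  have "real N \<le> rk (S \<union> File ` {n<..N})"
    by (rule order_trans[OF rk_files rk_mono]) (use assms in force)
  also have "\<dots> \<le> rk S + rk (File ` {n<..N})"
    by (rule rk_Un_le)
  also have "rk (File ` {n<..N}) \<le> real (card {n<..N}) * 1"
    by (intro rk_image_le rk_file) auto
  finally show ?thesis
    using assms by simp
qed

text \<open>The inequality for one shift \<open>i\<close>. The rank of window and \<open>A\<close>
  stays on the left because only its average over \<open>i\<close> is bounded below later.\<close>

lemma one_shift:
  fixes l :: nat
  assumes s: "s \<le> K" and i: "i < K" and p: "p = min (s + L - 1) K"
  defines "A \<equiv> File ` {1..min (l * s) N}"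
  shows "real (min (l * K) N) + rk (Cache ` accessed_caches K p i \<union> A)
    \<le> real p * M + real l * R + rk (Cache ` {1..K} \<union> A)"
proof -
  let ?d = "\<lambda>j. demand_vec K N s l i j"
  define W where "W = Cache ` accessed_caches K p i"
  define Z where "Z = Cache ` {1..K}"
  define X where "X = (\<lambda>j. Transmission (?d j)) ` {..<l}"
  define B where "B = File ` {1..min (l * K) N}"
  have d: "?d j \<in> demands K N" for j
    using N_pos by (rule demand_vec_in)
  have WZ: "W \<subseteq> Z"
    unfolding W_def Z_def using accessed_caches_subset[OF K_pos] by (rule image_mono)
  have decode: "rk (insert (File (?d j k)) T) \<le> rk T"
    if "k \<in> {1..K}" "j < l" "Cache ` accessed_caches K L k \<union> X \<subseteq> T" for j k T
  proof -
    have "Cache ` accessed_caches K L k \<union> {Transmission (?d j)} \<subseteq> T"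
      using that by (auto simp: X_def)
    with determined_mono[OF decodable[OF d that(1)]] show ?thesis
      by simp
  qed
  \<comment> \<open>Each file of \<open>A\<close> is requested by one of the \<open>s\<close> users,
    all of whose caches lie in the window.\<close>
  have "rk (W \<union> X \<union> A) = rk (W \<union> X)"
  proof (rule determined_Un)
    fix v assume "v \<in> A"
    then obtain n where n: "v = File n" "n \<in> {1..min (l * s) N}"
      by (auto simp: A_def)
    obtain j t where jt: "j < l" "t < s" "?d j (wrap K (i + t)) = n"
      using demand_vec_first_cover[OF i s n(2)] .
    then have "accessed_caches K L (wrap K (i + t)) \<subseteq> accessed_caches K p i"
      unfolding p by (intro accessed_caches_within K_pos)
    then have "Cache ` accessed_caches K L (wrap K (i + t)) \<union> X \<subseteq> W \<union> X"
      unfolding W_def by blast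
    from decode[OF wrap_in[OF K_pos] jt(1) this] show "rk (insert v (W \<union> X)) \<le> rk (W \<union> X)"
      using jt n by simp
  qed (simp add: A_def)
  moreover have "rk (Z \<union> X \<union> B) = rk (Z \<union> X)"
  proof (rule determined_Un)
    fix v assume "v \<in> B"
    then obtain n where n: "v = File n" "n \<in> {1..min (l * K) N}"
      by (auto simp: B_def)
    obtain j t where jt: "j < l" "t < K" "?d j (wrap K (i + t)) = n"
      using demand_vec_cover[OF i s n(2)] .
    have "Cache ` accessed_caches K L (wrap K (i + t)) \<union> X \<subseteq> Z \<union> X"
      unfolding Z_def using accessed_caches_subset[OF K_pos] by blast
    from decode[OF wrap_in[OF K_pos] jt(1) this] show "rk (insert v (Z \<union> X)) \<le> rk (Z \<union> X)"
      using jt n by simp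
  qed (simp add: B_def)
  moreover have "real (min (l * K) N) \<le> rk (Z \<union> X \<union> B)"
    by (intro rk_files_ge) (auto simp: B_def)
  \<comment> \<open>Submodularity for the two sets on the right: their union contains
    \<open>Z \<union> X\<close>, and their intersection contains \<open>W \<union> A\<close> because
    \<open>W \<subseteq> Z\<close>.\<close>
  moreover have "rk (Z \<union> X) + rk (W \<union> A) \<le> rk (W \<union> X \<union> A) + rk (Z \<union> A)"
    using rk_submodular[of "W \<union> X \<union> A" "Z \<union> A"] WZ
      rk_mono[of "Z \<union> X" "(W \<union> X \<union> A) \<union> (Z \<union> A)"]
      rk_mono[of "W \<union> A" "(W \<union> X \<union> A) \<inter> (Z \<union> A)"] by fastforce
  moreover have "rk (W \<union> X) \<le> real p * M + real l * R"
  proof -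
    have "rk W \<le> real (card (accessed_caches K p i)) * M"
      unfolding W_def
      using accessed_caches_subset[OF K_pos, of p i] by (intro rk_image_le rk_cache) auto
    also have "\<dots> \<le> real p * M"
      by (intro mult_right_mono of_nat_mono card_accessed_caches_le M_nonneg)
    finally have "rk W \<le> real p * M" .
    moreover have "rk X \<le> real (card {..<l}) * R"
      unfolding X_def by (intro rk_image_le rk_transmission d) auto
    ultimately show ?thesis
      using rk_Un_le[of W X] by simp
  qed
  ultimately show ?thesis
    unfolding W_def Z_def by linarith
qed

lemma rate_bound:
  fixes l :: nat
  assumes s: "s \<le> K" and p: "p = min (s + L - 1) K"
  shows "real N \<le> real l * R + (1 - real p / real K) * max 0 (real N - real l * real s)
    + max 0 (real N - real l * real K) + real p * M"
proof -
  define A where "A = File ` {1..min (l * s) N}"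
  define Y where "Y = Cache ` {1..K} \<union> A"
  have pK: "p \<le> K"
    by (simp add: p)
  have "(\<Sum>i<K. real (min (l * K) N) + rk (Cache ` accessed_caches K p i \<union> A))
      \<le> (\<Sum>i<K. real p * M + real l * R + rk Y)"
    unfolding A_def Y_def using one_shift[OF s _ p] by (intro sum_mono) simp
  moreover have "real p * rk Y + (real K - real p) * rk A
      \<le> (\<Sum>i<K. rk (Cache ` accessed_caches K p i \<union> A))"
    unfolding Y_def using K_pos pK by (rule sum_windows_ge)
  ultimately have "real K * real (min (l * K) N)
      \<le> real K * (real p * M + real l * R) + (real K - real p) * (rk Y - rk A)"
    by (simp add: sum.distrib algebra_simps)
  \<comment> \<open>The coefficient is nonnegative, \<open>Y\<close> has rank at most
    \<open>N\<close>, and \<open>A\<close> consists of \<open>min (l * s) N\<close> independent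
    files.\<close>
  also have "(real K - real p) * (rk Y - rk A) \<le> (real K - real p) * (real N - real (min (l * s) N))"
    using rk_le_N[of Y] rk_files_ge[of "min (l * s) N" A] pK
    by (intro mult_left_mono) (auto simp: A_def)
  also have "real N - real (min (l * s) N) = max 0 (real N - real l * real s)"
    by (simp add: min_def max_def flip: of_nat_mult)
  also have "(real K - real p) * max 0 (real N - real l * real s)
      = real K * ((1 - real p / real K) * max 0 (real N - real l * real s))"
    using K_pos by (simp add: field_simps)
  finally have "real (min (l * K) N)
      \<le> real p * M + real l * R + (1 - real p / real K) * max 0 (real N - real l * real s)"
    using K_pos by (simp flip: distrib_left)
  moreover have "real N - real (min (l * K) N) = max 0 (real N - real l * real K)"
    by (simp add: min_def max_def flip: of_nat_mult)
  ultimately show ?thesis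
    by linarith
qed

end


section \<open>Entropy of functions of a uniform random element\<close>

locale uniform_source =
  fixes A :: "'a set" and F :: nat
  assumes finite_A: "finite A" and A_nonempty: "A \<noteq> {}" and F_pos: "0 < F"
begin

abbreviation U :: "'a measure" where
  "U \<equiv> uniform_count_measure A"

sublocale information_space U "2 ^ F"
proof -
  interpret prob_space U
    by (rule prob_space_uniform_count_measure[OF finite_A A_nonempty])
  show "information_space U (2 ^ F)"
    by unfold_locales (use F_pos in simp)
qed

lemma space_U [simp]: "space U = A"
  by (simp add: space_uniform_count_measure)

lemma sets_U [simp]: "sets U = Pow A"
  by (simp add: sets_uniform_count_measure)

lemma simple_function_U: "simple_function U f"
  using finite_A by (simp add: simple_function_def)

lemma ent_cong:
  assumes "\<And>x. x \<in> A \<Longrightarrow> f x = g x"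
  shows "ent F U f = ent F U g"
proof -
  have "f ` A = g ` A"
    using assms by (intro image_cong) auto
  moreover have "distr U S f = distr U S g" for S
    using assms by (intro distr_cong) auto
  ultimately show ?thesis
    by (simp add: ent_def entropy_def)
qed

text \<open>On \<open>A\<close>, \<open>f\<close> factors through \<open>g\<close>, so data
  processing applies.\<close>

lemma ent_mono:
  assumes "\<And>x y. x \<in> A \<Longrightarrow> y \<in> A \<Longrightarrow> g x = g y \<Longrightarrow> f x = f y"
  shows "ent F U f \<le> ent F U g"
proof -
  \<comment> \<open>The factor map evaluates \<open>f\<close> at an arbitrary point of the fiber of
    \<open>g\<close>, on which \<open>f\<close> is constant.\<close>
  define h where "h v = f (SOME x. x \<in> A \<and> g x = v)" for v
  have "f x = (h \<circ> g) x" if "x \<in> A" for x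
  proof -
    have "(SOME y. y \<in> A \<and> g y = g x) \<in> A \<and> g (SOME y. y \<in> A \<and> g y = g x) = g x"
      using that by (intro someI[of "\<lambda>y. y \<in> A \<and> g y = g x"]) simp
    then show ?thesis
      using assms[OF that] by (simp add: h_def)
  qed
  then have "ent F U f = ent F U (h \<circ> g)"
    by (rule ent_cong)
  also have "\<dots> \<le> ent F U g"
    unfolding ent_def by (rule entropy_data_processing[OF simple_function_U])
  finally show ?thesis .
qed

lemma ent_Pair: "ent F U (\<lambda>x. (f x, g x)) = ent F U f + cond_ent F U g f"
  unfolding ent_def cond_ent_def by (rule entropy_chain_rule[OF simple_function_U simple_function_U])

text \<open>Replaces an expectation over values by an average over \<open>A\<close>, so that
  entropies of different variables become sums over one index set and can be combined
  termwise.\<close>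

lemma sum_image_prob: "(\<Sum>v\<in>f ` A. prob (f -` {v} \<inter> A) * \<phi> v) = (\<Sum>x\<in>A. \<phi> (f x)) / real (card A)"
proof -
  have "(\<Sum>x\<in>A. \<phi> (f x)) = (\<Sum>v\<in>f ` A. \<Sum>x\<in>{x \<in> A. f x = v}. \<phi> (f x))"
    by (rule sum.image_gen[OF finite_A])
  also have "\<dots> = (\<Sum>v\<in>f ` A. real (card (f -` {v} \<inter> A)) * \<phi> v)"
  proof (rule sum.cong)
    fix v
    have "{x \<in> A. f x = v} = f -` {v} \<inter> A"
      by auto
    then show "(\<Sum>x\<in>{x \<in> A. f x = v}. \<phi> (f x)) = real (card (f -` {v} \<inter> A)) * \<phi> v"
      by simp
  qed simp
  finally show ?thesis
    using finite_A by (simp add: measure_uniform_count_measure sum_divide_distrib)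
qed

lemma ent_eq_sum: "ent F U f = - (\<Sum>x\<in>A. log (2 ^ F) (prob (f -` {f x} \<inter> A))) / real (card A)"
  using entropy_simple_distributed[OF simple_distributedI[OF simple_function_U[of f] measure_nonneg refl]]
  by (simp add: ent_def sum_image_prob)

lemma prob_fiber_pos: "x \<in> A \<Longrightarrow> 0 < prob (f -` {f x} \<inter> A)"
proof -
  assume "x \<in> A"
  then have "0 < card (f -` {f x} \<inter> A)" "0 < card A"
    using finite_A by (auto simp: card_gt_0_iff)
  then show ?thesis
    using finite_A by (simp add: measure_uniform_count_measure)
qed

text \<open>This is nonnegativity of the conditional mutual information of \<open>f\<close> and
  \<open>g\<close> given \<open>h\<close>, written in entropies.\<close>

lemma ent_submodular:
  "ent F U (\<lambda>x. (f x, g x, h x)) + ent F U h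
    \<le> ent F U (\<lambda>x. (f x, h x)) + ent F U (\<lambda>x. (g x, h x))"
proof -
  let ?p = "\<lambda>f v. prob (f -` {v} \<inter> A)"
  let ?l = "\<lambda>f x. log (2 ^ F) (?p f (f x))"
  note sd = simple_distributedI[OF simple_function_U measure_nonneg refl]
  have "0 \<le> (\<Sum>v\<in>(\<lambda>x. (f x, g x, h x)) ` A. ?p (\<lambda>x. (f x, g x, h x)) v *
      (case v of (a, b, c) \<Rightarrow> log (2 ^ F) (?p (\<lambda>x. (f x, g x, h x)) v /
        (?p (\<lambda>x. (f x, h x)) (a, c) * (?p (\<lambda>x. (g x, h x)) (b, c) / ?p h c)))))"
    using conditional_mutual_information_nonneg[OF simple_function_U[of f] simple_function_U[of g] simple_function_U[of h]]
    unfolding conditional_mutual_information_eq[OF sd sd sd sd] by (simp add: split_beta)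
  also have "\<dots> = (\<Sum>x\<in>A. log (2 ^ F) (?p (\<lambda>x. (f x, g x, h x)) (f x, g x, h x) /
        (?p (\<lambda>x. (f x, h x)) (f x, h x) * (?p (\<lambda>x. (g x, h x)) (g x, h x) / ?p h (h x))))) / real (card A)"
    by (simp add: sum_image_prob)
  \<comment> \<open>The logarithm splits because the fiber through a point of \<open>A\<close> has
    positive probability.\<close>
  also have "\<dots> = (\<Sum>x\<in>A. ?l (\<lambda>x. (f x, g x, h x)) x + ?l h x
      - ?l (\<lambda>x. (f x, h x)) x - ?l (\<lambda>x. (g x, h x)) x) / real (card A)"
    using prob_fiber_pos[of _ "\<lambda>x. (f x, g x, h x)"] prob_fiber_pos[of _ h]
      prob_fiber_pos[of _ "\<lambda>x. (f x, h x)"] prob_fiber_pos[of _ "\<lambda>x. (g x, h x)"]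
    by (intro arg_cong2[of _ _ _ _ "(/)"] sum.cong refl)
      (simp add: log_divide_pos log_mult_pos)
  finally show ?thesis
    by (simp add: ent_eq_sum sum.distrib sum_subtractf diff_divide_distrib add_divide_distrib)
qed

lemma ent_le_card: "ent F U f \<le> log (2 ^ F) (real (card (f ` A)))"
  using entropy_le_card[OF simple_distributedI[OF simple_function_U[of f] measure_nonneg refl]]
  by (simp add: ent_def)

lemma ent_const: "ent F U (\<lambda>_. c) = 0"
  using prob_space by (simp add: ent_eq_sum vimage_def)

lemma ent_id: "ent F U (\<lambda>x. x) = log (2 ^ F) (real (card A))"
proof -
  have n: "0 < card A"
    using finite_A A_nonempty by (simp add: card_gt_0_iff)
  have "prob ((\<lambda>x. x) -` {x} \<inter> A) = 1 / real (card A)" if "x \<in> A" for x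
    using that finite_A by (simp add: measure_uniform_count_measure vimage_def)
  then show ?thesis
    using n by (simp add: ent_eq_sum log_divide)
qed

section \<open>Transport of entropy and the entropy polymatroid\<close>

lemma measurable_U: "f ` A \<subseteq> B \<Longrightarrow> f \<in> measurable U (count_space B)"
  by (auto simp: measurable_def)

text \<open>Entropy depends only on the distribution. Surjectivity of \<open>\<pi>\<close> onto
  \<open>A\<close> makes the count spaces in \<open>ent\<close> and \<open>cond_ent\<close> agree as
  well.\<close>

lemma
  assumes "prob_space P" and [measurable]: "\<pi> \<in> measurable P U"
    and distr: "distr P U \<pi> = U" and img: "\<pi> ` space P = A"
  shows ent_pullback: "ent F P (\<lambda>\<omega>. f (\<pi> \<omega>)) = ent F U f"
    and cond_ent_pullback: "cond_ent F P (\<lambda>\<omega>. f (\<pi> \<omega>)) (\<lambda>\<omega>. g (\<pi> \<omega>)) = cond_ent F U f g"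
proof -
  interpret P: prob_space P by fact
  have f[measurable]: "f \<in> measurable U (count_space (f ` A))"
    and g[measurable]: "g \<in> measurable U (count_space (g ` A))"
    by (simp_all add: measurable_U)
  have sp: "(\<lambda>\<omega>. f (\<pi> \<omega>)) ` space P = f ` A" "(\<lambda>\<omega>. g (\<pi> \<omega>)) ` space P = g ` A"
    using img by auto
  have "distr P (count_space (f ` A)) (\<lambda>\<omega>. f (\<pi> \<omega>)) = distr U (count_space (f ` A)) f"
    using distr_distr[OF f assms(2)] by (simp add: distr comp_def)
  then show "ent F P (\<lambda>\<omega>. f (\<pi> \<omega>)) = ent F U f"
    by (simp add: ent_def entropy_def P.entropy_def sp)
  have "distr P (count_space (f ` A) \<Otimes>\<^sub>M count_space (g ` A)) (\<lambda>\<omega>. (f (\<pi> \<omega>), g (\<pi> \<omega>)))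
      = distr U (count_space (f ` A) \<Otimes>\<^sub>M count_space (g ` A)) (\<lambda>x. (f x, g x))"
    using distr_distr[of "\<lambda>x. (f x, g x)" U "count_space (f ` A) \<Otimes>\<^sub>M count_space (g ` A)" \<pi> P]
    by (simp add: distr comp_def)
  moreover have "distr P (count_space (g ` A)) (\<lambda>\<omega>. g (\<pi> \<omega>)) = distr U (count_space (g ` A)) g"
    using distr_distr[OF g assms(2)] by (simp add: distr comp_def)
  ultimately show "cond_ent F P (\<lambda>\<omega>. f (\<pi> \<omega>)) (\<lambda>\<omega>. g (\<pi> \<omega>)) = cond_ent F U f g"
    by (simp add: cond_ent_def conditional_entropy_def P.conditional_entropy_def sp)
qed

end

lemma restrict_eq_iff: "restrict f S = restrict g S \<longleftrightarrow> (\<forall>x\<in>S. f x = g x)"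
  by (auto simp: restrict_def fun_eq_iff)

text \<open>Joint entropy as a rank function; \<open>restrict\<close> packs the variables indexed by
  any set into one random variable.\<close>

lemma (in uniform_source) polymatroid_ent:
  "polymatroid (\<lambda>S. ent F U (\<lambda>x. restrict (\<lambda>v. V v x) S))"
proof
  show "ent F U (\<lambda>x. restrict (\<lambda>v. V v x) {}) = 0"
    by (simp add: restrict_def ent_const)
next
  fix S T :: "'b set" assume "S \<subseteq> T"
  then show "ent F U (\<lambda>x. restrict (\<lambda>v. V v x) S) \<le> ent F U (\<lambda>x. restrict (\<lambda>v. V v x) T)"
    by (intro ent_mono) (auto simp: restrict_eq_iff)
next
  fix S T :: "'b set"
  let ?r = "\<lambda>S x. restrict (\<lambda>v. V v x) S"
  \<comment> \<open>Carrying the intersection as a redundant component brings the tuples into the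
    form of \<open>ent_submodular\<close>.\<close>
  have "ent F U (?r (S \<union> T)) \<le> ent F U (\<lambda>x. (?r S x, ?r T x, ?r (S \<inter> T) x))"
    by (intro ent_mono) (auto simp: restrict_eq_iff)
  moreover have "ent F U (\<lambda>x. (?r T x, ?r (S \<inter> T) x)) \<le> ent F U (?r T)"
    by (intro ent_mono) (auto simp: restrict_eq_iff)
  moreover have "ent F U (\<lambda>x. (?r S x, ?r (S \<inter> T) x)) \<le> ent F U (?r S)"
    by (intro ent_mono) (auto simp: restrict_eq_iff)
  ultimately show "ent F U (?r (S \<union> T)) + ent F U (?r (S \<inter> T)) \<le> ent F U (?r S) + ent F U (?r T)"
    using ent_submodular[of "?r S" "?r T" "?r (S \<inter> T)"] by linarith
qed


section \<open>Entropies of a scheme\<close>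

lemma finite_libraries [simp]: "finite (libraries N F)"
  and libraries_nonempty [simp]: "libraries N F \<noteq> {}"
  and card_libraries: "card (libraries N F) = (2 ^ F) ^ N"
proof -
  have "finite {w :: bool list. length w = F}" "card {w :: bool list. length w = F} = 2 ^ F"
    using finite_lists_length_eq[of "UNIV :: bool set" F] card_lists_length_eq[of "UNIV :: bool set" F]
    by simp_all
  then show "finite (libraries N F)" "card (libraries N F) = (2 ^ F) ^ N"
    by (auto simp: libraries_def card_PiE intro!: finite_PiE)
  then show "libraries N F \<noteq> {}"
    by (metis card.empty power_not_zero zero_neq_numeral)
qed

lemma finite_demands [simp]: "finite (demands K N)"
  by (simp add: demands_def finite_PiE)

lemma demands_nonempty: "0 < N \<Longrightarrow> demands K N \<noteq> {}"
  by (auto simp: demands_def PiE_eq_empty_iff)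

text \<open>Conditioning on an event about the demands alone leaves the library uniform. Taking
  \<open>D' = D\<close> covers the unconditioned space.\<close>

lemma prod_marginal:
  assumes "finite A" "A \<noteq> {}" "finite D" "D' \<subseteq> D" "D' \<noteq> {}"
  defines "P \<equiv> uniform_measure (uniform_count_measure (A \<times> D)) (A \<times> D')"
  shows "prob_space P" "fst \<in> measurable P (uniform_count_measure A)"
    "distr P (uniform_count_measure A) fst = uniform_count_measure A" "fst ` space P = A"
proof -
  let ?M = "uniform_count_measure (A \<times> D)"
  have sp: "space P = A \<times> D" and sets: "sets P = Pow (A \<times> D)"
    by (simp_all add: P_def space_uniform_count_measure sets_uniform_count_measure)
  have D': "finite D'"
    using assms finite_subset by auto
  have AD: "A \<times> D' \<subseteq> A \<times> D"
    using assms by auto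
  have pos: "card A > 0" "card D > 0" "card D' > 0"
    using assms D' by (auto simp: card_gt_0_iff)
  have em: "emeasure ?M (B \<times> D') = ennreal (real (card B * card D') / real (card A * card D))"
    if "B \<subseteq> A" for B
    using that assms by (subst emeasure_uniform_count_measure) (auto simp: card_cartesian_product)
  show "prob_space P"
    unfolding P_def using em[of A] pos
    by (intro prob_space_uniform_measure) auto
  show fst: "fst \<in> measurable P (uniform_count_measure A)"
    using sp sets by (auto simp: measurable_def space_uniform_count_measure sets_uniform_count_measure)
  show "fst ` space P = A"
    unfolding sp using \<open>D' \<subseteq> D\<close> \<open>D' \<noteq> {}\<close> by auto
  show "distr P (uniform_count_measure A) fst = uniform_count_measure A"
  proof (rule measure_eqI)
    fix B assume "B \<in> sets (distr P (uniform_count_measure A) fst)"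
    then have B: "B \<subseteq> A"
      by (simp add: sets_uniform_count_measure)
    have "emeasure (distr P (uniform_count_measure A) fst) B = emeasure P (B \<times> D)"
      using B by (subst emeasure_distr[OF fst])
        (auto simp: sets_uniform_count_measure sp intro!: arg_cong[of _ _ "emeasure P"])
    also have "\<dots> = emeasure ?M ((A \<times> D') \<inter> (B \<times> D)) / emeasure ?M (A \<times> D')"
      unfolding P_def using AD B
      by (intro emeasure_uniform_measure) (auto simp: sets_uniform_count_measure)
    also have "(A \<times> D') \<inter> (B \<times> D) = B \<times> D'"
      using B assms by auto
    also have "emeasure ?M (B \<times> D') / emeasure ?M (A \<times> D') = ennreal (real (card B) / real (card A))"
      using pos by (simp add: em B divide_ennreal)
    also have "\<dots> = emeasure (uniform_count_measure A) B"
      using assms B by (simp add: emeasure_uniform_count_measure)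
    finally show "emeasure (distr P (uniform_count_measure A) fst) B = emeasure (uniform_count_measure A) B" .
  qed simp
qed

lemma uniform_measure_space:
  assumes "prob_space M"
  shows "uniform_measure M (space M) = M"
proof (rule measure_eqI)
  fix B assume "B \<in> sets (uniform_measure M (space M))"
  then show "emeasure (uniform_measure M (space M)) B = emeasure M B"
    using assms sets.sets_into_space[of B M]
    by (simp add: prob_space.emeasure_space_1 Int_absorb1 divide_ennreal_def)
qed simp

locale macc_source =
  fixes N F :: nat
  assumes N_pos: "0 < N" and "0 < F"

sublocale macc_source \<subseteq> uniform_source "libraries N F" F
  using macc_source_axioms unfolding macc_source_def by unfold_locales simp_all

context macc_source
begin

lemma ent_macc_space: "ent F (macc_space K N F) (\<lambda>\<omega>. f (fst \<omega>)) = ent F U f"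
proof (rule ent_pullback)
  let ?M = "macc_space K N F"
  have "prob_space ?M"
    unfolding macc_space_def using demands_nonempty[OF N_pos]
    by (intro prob_space_uniform_count_measure) auto
  then have "?M = uniform_measure (uniform_count_measure (libraries N F \<times> demands K N)) (libraries N F \<times> demands K N)"
    using uniform_measure_space[of ?M] by (simp add: macc_space_def space_uniform_count_measure)
  then show "prob_space ?M" "fst \<in> measurable ?M U" "distr ?M U fst = U" "fst ` space ?M = libraries N F"
    using prod_marginal[of "libraries N F" "demands K N" "demands K N"] demands_nonempty[OF N_pos] by simp_all
qed

lemma cond_ent_given_demand:
  assumes "d \<in> demands K N"
  shows "cond_ent F (given_demand K N F k (d k)) (\<lambda>\<omega>. f (fst \<omega>)) (\<lambda>\<omega>. g (fst \<omega>)) = cond_ent F U f g"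
proof (rule cond_ent_pullback)
  let ?M = "given_demand K N F k (d k)"
  let ?D = "{e \<in> demands K N. e k = d k}"
  have "{\<omega> \<in> space (macc_space K N F). demand k \<omega> = d k} = libraries N F \<times> ?D"
    by (auto simp: macc_space_def space_uniform_count_measure demand_def)
  then have "?M = uniform_measure (uniform_count_measure (libraries N F \<times> demands K N)) (libraries N F \<times> ?D)"
    by (simp add: given_demand_def macc_space_def)
  then show "prob_space ?M" "fst \<in> measurable ?M U" "distr ?M U fst = U" "fst ` space ?M = libraries N F"
    using prod_marginal[of "libraries N F" "demands K N" ?D] assms by auto
qed

text \<open>Eliminates the random demands: every constraint becomes one on the uniform
  library.\<close>

lemma macc_scheme_iff:
  "macc_scheme K L N F M R Z X \<longleftrightarrow>
     (\<forall>k\<in>{1..K}. ent F U (Z k) \<le> M) \<and>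
     (\<forall>d\<in>demands K N. ent F U (X d) \<le> R \<and>
        (\<forall>k\<in>{1..K}. cond_ent F U (\<lambda>w. w (d k))
             (\<lambda>w. (cached Z (accessed_caches K L k) w, X d w)) = 0))"
proof -
  have "cond_ent F (given_demand K N F k (d k)) (file_at (d k))
      (\<lambda>\<omega>. (cached Z (accessed_caches K L k) (fst \<omega>), X d (fst \<omega>)))
    = cond_ent F U (\<lambda>w. w (d k)) (\<lambda>w. (cached Z (accessed_caches K L k) w, X d w))"
    if "d \<in> demands K N" for d k
    using cond_ent_given_demand[OF that, of k "\<lambda>w. w (d k)"
        "\<lambda>w. (cached Z (accessed_caches K L k) w, X d w)"]
    by (simp add: file_at_def[abs_def])
  then show ?thesis
    by (simp add: macc_scheme_def ent_macc_space)
qed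

lemma ent_id_libraries: "ent F U (\<lambda>w. w) = real N"
proof -
  have "log (2 ^ F) ((2 ^ F) ^ N) = real N * log (2 ^ F) (2 ^ F)"
    by (rule log_nat_power) simp
  also have "log (2 ^ F) (2 ^ F) = (1 :: real)"
    using b_gt_1 by (intro log_eq_one) auto
  finally show ?thesis
    by (simp add: ent_id card_libraries)
qed

lemma ent_file_le:
  assumes "n \<in> {1..N}"
  shows "ent F U (\<lambda>w. w n) \<le> 1"
proof -
  have "card ((\<lambda>w. w n) ` libraries N F) \<le> card {w :: bool list. length w = F}"
    using assms finite_lists_length_eq[of "UNIV :: bool set" F]
    by (intro card_mono) (auto simp: libraries_def)
  then have "real (card ((\<lambda>w. w n) ` libraries N F)) \<le> 2 ^ F"
    using card_lists_length_eq[of "UNIV :: bool set" F] by simp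
  moreover have "0 < card ((\<lambda>w. w n) ` libraries N F)"
    by (simp add: card_gt_0_iff)
  ultimately have "log (2 ^ F) (real (card ((\<lambda>w. w n) ` libraries N F))) \<le> log (2 ^ F) (2 ^ F)"
    using b_gt_1 by (subst log_le_cancel_iff) auto
  also have "\<dots> = 1"
    using b_gt_1 by (intro log_eq_one) auto
  finally show ?thesis
    using ent_le_card[of "\<lambda>w. w n"] by linarith
qed

end

text \<open>The injective encoding \<open>to_nat\<close> gives all variables one value type without
  losing information.\<close>

fun macc_val :: "(nat \<Rightarrow> (nat \<Rightarrow> bool list) \<Rightarrow> nat) \<Rightarrow> ((nat \<Rightarrow> nat) \<Rightarrow> (nat \<Rightarrow> bool list) \<Rightarrow> nat)
    \<Rightarrow> macc_var \<Rightarrow> (nat \<Rightarrow> bool list) \<Rightarrow> nat" where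
  "macc_val Z X (File n) w = to_nat (w n)"
| "macc_val Z X (Cache k) w = Z k w"
| "macc_val Z X (Transmission d) w = X d w"

lemma (in macc_source) macc_polymatroid:
  assumes "0 < K" "0 \<le> M" and scheme: "macc_scheme K L N F M R Z X"
  shows "macc_polymatroid (\<lambda>S. ent F U (\<lambda>w. restrict (\<lambda>v. macc_val Z X v w) S)) K L N M R"
proof -
  let ?rk = "\<lambda>S. ent F U (\<lambda>w. restrict (\<lambda>v. macc_val Z X v w) S)"
  interpret polymatroid ?rk
    by (rule polymatroid_ent)
  have memory: "ent F U (Z k) \<le> M" if "k \<in> {1..K}" for k
    using scheme that by (simp add: macc_scheme_iff)
  have rate: "ent F U (X d) \<le> R" if "d \<in> demands K N" for d
    using scheme that by (simp add: macc_scheme_iff)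
  have decode: "cond_ent F U (\<lambda>w. w (d k)) (\<lambda>w. (cached Z (accessed_caches K L k) w, X d w)) = 0"
    if "d \<in> demands K N" "k \<in> {1..K}" for d k
    using scheme that by (simp add: macc_scheme_iff)
  show ?thesis
  proof unfold_locales
    show "0 < K" "0 < N" "0 \<le> M"
      using assms N_pos by auto
    have "ent F U (\<lambda>w. w) \<le> ?rk (File ` {1..N})"
      by (intro ent_mono) (auto simp: restrict_eq_iff libraries_def intro: PiE_ext)
    then show "real N \<le> ?rk (File ` {1..N})"
      by (simp add: ent_id_libraries)
    show "?rk S \<le> real N" for S
      using ent_mono[of "\<lambda>w. w" "\<lambda>w. restrict (\<lambda>v. macc_val Z X v w) S"] by (simp add: ent_id_libraries)
    show "?rk {File n} \<le> 1" if "n \<in> {1..N}" for n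
      by (rule order_trans[OF ent_mono ent_file_le[OF that]]) (auto simp: restrict_eq_iff)
    show "?rk {Cache k} \<le> M" if "k \<in> {1..K}" for k
      by (rule order_trans[OF ent_mono memory[OF that]]) (auto simp: restrict_eq_iff)
    show "?rk {Transmission d} \<le> R" if "d \<in> demands K N" for d
      by (rule order_trans[OF ent_mono rate[OF that]]) (auto simp: restrict_eq_iff)
    fix d k assume dk: "d \<in> demands K N" "k \<in> {1..K}"
    let ?S = "Cache ` accessed_caches K L k \<union> {Transmission d}"
    let ?Y = "\<lambda>w. (cached Z (accessed_caches K L k) w, X d w)"
    \<comment> \<open>Decodability enters through the chain rule: appending the requested file to
      \<open>?Y\<close> adds its conditional entropy, which is 0.\<close>
    have "?rk (insert (File (d k)) ?S) \<le> ent F U (\<lambda>w. (?Y w, w (d k)))"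
      by (intro ent_mono) (auto simp: restrict_eq_iff cached_def)
    also have "\<dots> = ent F U ?Y"
      using decode[OF dk] by (simp add: ent_Pair)
    also have "\<dots> \<le> ?rk ?S"
      by (intro ent_mono) (auto simp: restrict_eq_iff cached_def)
    finally show "?rk (insert (File (d k)) ?S) \<le> ?rk ?S" .
  qed
qed

text \<open>Makes the set under \<open>Inf\<close> nonempty. The witness has one-bit files, constant
  caches, and a transmission of the whole library.\<close>

lemma achievable_exists:
  assumes "0 < N" "0 \<le> M"
  obtains R where "achievable K L N M R"
proof -
  interpret macc_source N 1
    using assms by unfold_locales auto
  define X :: "(nat \<Rightarrow> nat) \<Rightarrow> (nat \<Rightarrow> bool list) \<Rightarrow> nat"
    where "X d w = to_nat (map w [1..<Suc N])" for d w
  define Z :: "nat \<Rightarrow> (nat \<Rightarrow> bool list) \<Rightarrow> nat" where "Z k w = 0" for k w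
  \<comment> \<open>\<open>X\<close> ignores the demand vector, so \<open>undefined\<close>
    represents them all; \<open>max 0\<close> secures the required \<open>0 \<le> R\<close>.\<close>
  define R where "R = max 0 (ent 1 U (X undefined))"
  have "cond_ent 1 U (\<lambda>w. w (d k)) (\<lambda>w. (cached Z (accessed_caches K L k) w, X d w)) = 0"
    (is "cond_ent 1 U ?W ?Y = 0") if "d \<in> demands K N" "k \<in> {1..K}" for d k
  proof -
    have "d k \<in> {1..N}"
      using that by (auto simp: demands_def)
    then have "v (d k) = w (d k)" if "X d v = X d w" for v w
      using that by (auto simp: X_def simp del: upt_Suc)
    then have "ent 1 U (\<lambda>w. (?Y w, ?W w)) = ent 1 U ?Y"
      by (intro order_antisym[of "ent 1 U (\<lambda>w. (?Y w, ?W w))"] ent_mono) auto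
    then show ?thesis
      using ent_Pair[of ?Y ?W] by linarith
  qed
  moreover have "ent 1 U (X d) \<le> R" for d
    by (simp add: R_def X_def[abs_def])
  moreover have "ent 1 U (Z k) \<le> M" for k
    using assms ent_const[of "0 :: nat"] by (simp add: Z_def[abs_def])
  ultimately have "macc_scheme K L N 1 M R Z X"
    unfolding macc_scheme_iff by blast
  then have "achievable K L N M R"
    unfolding achievable_def by (auto simp: R_def)
  then show thesis ..
qed

section \<open>From individual schemes to the optimal rate\<close>

theorem theorem2:
  fixes K L N :: nat and M :: real
  assumes "0 < K" "0 < L" "0 < N" "L \<le> K"
    and "0 \<le> M" "M \<le> real N"
  shows "opt_rate K L N M \<ge>
    Max ((\<lambda>(s, l). let p = real (min (s + L - 1) K) in
            1 / real l *
              (real N - (1 - p / real K) * max 0 (real N - real l * real s)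
                - max 0 (real N - real l * real K) - p * M))
         ` (SIGMA s : {1..K}. {1..nat \<lceil>real N / real s\<rceil>}))"
    (is "_ \<ge> Max (?f ` ?I)")
proof -
  define f where "f = ?f"
  define I where "I = ?I"
  have bound: "f x \<le> R" if "x \<in> I" "achievable K L N M R" for x R
  proof -
    obtain s l where x: "x = (s, l)"
      by fastforce
    from that(2) obtain F Z X where F: "0 < F" and scheme: "macc_scheme K L N F M R Z X"
      by (auto simp: achievable_def)
    interpret macc_source N F
      using assms F by unfold_locales
    interpret macc_polymatroid "\<lambda>S. ent F U (\<lambda>w. restrict (\<lambda>v. macc_val Z X v w) S)" K L N M R
      using assms scheme by (intro macc_polymatroid)
    have "s \<le> K" "0 < l"
      using that(1) by (auto simp: x I_def)
    define c where "c = real N - (1 - real (min (s + L - 1) K) / real K) * max 0 (real N - real l * real s)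
      - max 0 (real N - real l * real K) - real (min (s + L - 1) K) * M"
    have "c \<le> R * real l"
      using rate_bound[OF \<open>s \<le> K\<close> refl, of l] by (simp only: c_def mult.commute[of R])
    then have "1 / real l * c \<le> R"
      using \<open>0 < l\<close> by (simp add: pos_divide_le_eq)
    then show ?thesis
      by (simp only: x f_def c_def Let_def prod.case)
  qed
  \<comment> \<open>Finiteness and nonemptiness make \<open>Max\<close> meaningful.\<close>
  have "finite I" "(1, 1) \<in> I"
    using assms by (auto simp: I_def)
  then have Max_le: "Max (f ` I) \<le> R" if "achievable K L N M R" for R
    using bound[OF _ that] by (intro Max.boundedI) blast+
  obtain R where "achievable K L N M R"
    using achievable_exists[OF assms(3,5)] .
  then have "Max (f ` I) \<le> opt_rate K L N M"
    unfolding opt_rate_def using Max_le by (intro cInf_greatest) blast+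
  then show ?thesis
    unfolding f_def I_def .
qed

end
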